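(* Let problem (P), problems (P)$^\nu$ ($\nu\in\mathbb{N}$), their minimum values $\mathfrak{m}$, $\mathfrak{m}^\nu$, and the value function $V$ be as defined in the context. Assume all of the following. (A1) $X\subset\mathbb{R}^n$, $Y\subset\mathbb{R}^m$, $D\subset\mathbb{R}^q$ are nonempty and closed. (A2) The sets $Y^\nu$, $\nu\in\mathbb{N}$, are nonempty subsets of $Y$ and $Y^\nu\to Y$ in the sense of Painlevé–Kuratowski. (A3) For a sequence $\delta^\nu\to 0$, the functions $g,g^\nu:\mathbb{R}^n\times\mathbb{R}^m\to\mathbb{R}$ satisfy $\sup_{x\in X,y\in Y}|g^\nu(x,y)-g(x,y)|\le\delta^\nu$ for all $\nu\in\mathbb{N}$, and $g$ is continuous relative to $X\times Y$. (A4) For a sequence $\eta^\nu\to 0$, the mappings $H,H^\nu:\mathbb{R}^n\times\mathbb{R}^m\to\mathbb{R}^q$ satisfy $\sup_{x\in X,y\in Y}\big|\operatorname{dist}(H^\nu(x,y),D)-\operatorname{dist}(H(x,y),D)\big|\le\eta^\nu$ for all $\nu\in\mathbb{N}$, and $H$ is continuous relative to $X\times Y$. (A5) For all $x\in X$ and $y\in Y$, the functions $f,f^\nu:\mathbb{R}^n\times\mathbb{R}^m\to(-\infty,\infty]$ satisfy $\limsup_\nu f^\nu(x,y)\le f(x,y)$, and $\liminf_\nu f^\nu(x^\nu,y^\nu)\ge f(x,y)$ whenever $x^\nu\in X\to x$ and $y^\nu\in Y\to y$. (A6) The nonnegative parameters $\sigma^\nu,\theta^\nu,\bar\lambda^\nu$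 satisfy $\bar\lambda^\nu\to\infty$, $\sigma^\nu\eta^\nu\to0$, $\theta^\nu\bar\lambda^\nu\eta^\nu\to0$, and $\theta^\nu\delta^\nu\to0$. Suppose moreover that $\theta^\nu|\tau^\nu-\tau|\to0$ and that there exists an optimal solution $(x^\star,y^\star)$ of (P) such that $V$ is calm at $x^\star$. Then the following hold: (a) If $\{\theta^\nu,\nu\in\mathbb{N}\}$ is bounded away from zero, then $\limsup_\nu\mathfrak{m}^\nu\le\mathfrak{m}\in\mathbb{R}$. (b) Suppose that $\sigma^\nu,\theta^\nu\to\infty$ and there is a compact set $B\subset\mathbb{R}^{n+m+q+2}$ such that for each $\nu\in\mathbb{N}$ there exists an optimal solution of (P)$^\nu$ in $B$. Let $\lambda^\star\in[0,\infty)$ be a penalty threshold for $V$ at $x^\star$. If $\lambda\in[\lambda^\star,\infty)$, then there exist a sequence $\{\epsilon^\nu\in[0,\infty),\nu\in\mathbb{N}\}$ converging to $0$ and a sequence $\{w^\nu\in\mathbb{R}^{n+m+q+2},\nu\in\mathbb{N}\}$ such that $w^\nu$ is an $\epsilon^\nu$-optimal solution of (P)$^\nu$ and $w^\nu\to(x^\star,y^\star,0,0,\lambda)$. Moreover, $\lim_\nu\mathfrak{m}^\nu=\mathfrak{m}\in\mathbb{R}$. (c) Suppose that $\sigma^\nu\to\infty$, $\theta^\nu\to\infty$, $\epsilon^\nu\to0$ (with $\epsilon^\nu\in[0,\infty)$), and, for each $\nu\in\mathbb{N}$, $(x^\nu,y^\nu,u^\nu,\alpha^\nu,\lambda^\nu)$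 is an $\epsilon^\nu$-optimal solution of (P)$^\nu$. If there are a subsequence $N\subset\mathbb{N}$ and a point $(\hat x,\hat y,\hat u,\hat\alpha,\hat\lambda)$ such that $(x^\nu,y^\nu,u^\nu,\alpha^\nu,\lambda^\nu)\to(\hat x,\hat y,\hat u,\hat\alpha,\hat\lambda)$ along $\nu\in N$, then $(\hat x,\hat y)$ is an optimal solution of (P) and $\mathfrak{m}^\nu\to\mathfrak{m}\in\mathbb{R}$ along $\nu\in N$.
   Context: Fix an arbitrary norm $\|\cdot\|$ on $\mathbb{R}^q$; for $a\in\mathbb{R}^q$, $\operatorname{dist}(a,D)=\inf_{a'\in D}\|a-a'\|$. Infima over the empty set equal $\infty$. Problem (P), with $\tau\in[0,\infty)$: minimize $f(x,y)$ over $x\in X$, $y\in\mathbb{R}^m$ subject to $y\in\tau\text{-}\operatorname{argmin}_{z\in Y}\{g(x,z)\mid H(x,z)\in D\}$; that is, $y\in Y$, $H(x,y)\in D$ and $g(x,y)\le\inf_{z\in Y}\{g(x,z)\mid H(x,z)\in D\}+\tau$. $\mathfrak{m}$ is the infimum of $f(x,y)$ over points satisfying the stated constraints ($\infty$ if there are none). An optimal solution of (P) is a point $(x,y)$ satisfying these constraints with $f(x,y)<\infty$ and $f(x,y)\le\mathfrak{m}$. Problem (P)$^\nu$, with parameters $\sigma^\nu,\theta^\nu,\bar\lambda^\nu,\tau^\nu\in[0,\infty)$: minimize $f^\nu(x,y)+\sigma^\nu\|u\|-\theta^\nu\alpha$ over $(x,y,u,\alpha,\lambda)$ subject to $H^\nu(x,y)+u\in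 D$; $\;g^\nu(x,y)+\alpha\le g^\nu(x,z)+\lambda\operatorname{dist}(H^\nu(x,z),D)+\tau^\nu$ for all $z\in Y^\nu$; $\;x\in X$, $y\in Y$, $u\in\mathbb{R}^q$, $\alpha\in(-\infty,0]$, $\lambda\in[0,\bar\lambda^\nu]$. $\mathfrak{m}^\nu$ is the infimum of its objective function over points satisfying these constraints ($\infty$ if there are none). For $\epsilon\in[0,\infty)$, an $\epsilon$-optimal solution of (P)$^\nu$ is a point satisfying its constraints with objective value finite and at most $\mathfrak{m}^\nu+\epsilon$; an optimal solution is a $0$-optimal solution. Value function: $V(x,u)=\inf_{y\in Y}\{g(x,y)\mid H(x,y)+u\in D\}$ for $x\in\mathbb{R}^n$, $u\in\mathbb{R}^q$. $V$ is calm at $x$ if there is $\lambda\in[0,\infty)$ such that $V(x,u)\ge V(x,0)-\lambda\|u\|$ for all $u\in\mathbb{R}^q$; such a $\lambda$ is called a penalty threshold for $V$ at $x$. $Y^\nu\to Y$ in the sense of Painlevé–Kuratowski means that $Y$ is closed and the distance from $y$ to $Y^\nu$ converges to the distance from $y$ to $Y$ for all $y\in\mathbb{R}^m$. A function $\psi$ is continuous relative to a set $C$ if $\psi(w^\nu)\to\psi(w)$ whenever $w^\nu\in C\to w\in C$. A subsequence $N\subset\mathbb{N}$ is an infinite subset of indices. *)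

theory Defs
  imports "HOL-Analysis.Analysis"
begin

text \<open>An arbitrary norm on a real vector space, as a function. The type-class norm of
  \<open>real ^ 'q\<close> is the Euclidean one, so it cannot play this role.\<close>

definition is_norm :: "('a::real_vector \<Rightarrow> real) \<Rightarrow> bool" where
  "is_norm nrm \<longleftrightarrow>
     (\<forall>a. 0 \<le> nrm a) \<and>
     (\<forall>a. nrm a = 0 \<longleftrightarrow> a = 0) \<and>
     (\<forall>c a. nrm (c *\<^sub>R a) = \<bar>c\<bar> * nrm a) \<and>
     (\<forall>a b. nrm (a + b) \<le> nrm a + nrm b)"

text \<open>A real infimum: intended for nonempty \<open>D\<close> only.\<close>

definition nrm_dist :: "('a::real_vector \<Rightarrow> real) \<Rightarrow> 'a \<Rightarrow> 'a set \<Rightarrow> real" where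
  "nrm_dist nrm a D = (INF a'\<in>D. nrm (a - a'))"

text \<open>Painleve-Kuratowski convergence, for nonempty sets only (\<open>infdist\<close> to the empty set is 0).
  In finite dimension the choice of the norm behind the distance is immaterial.\<close>

definition PK_converges :: "(nat \<Rightarrow> ('a::euclidean_space) set) \<Rightarrow> 'a set \<Rightarrow> bool" where
  "PK_converges Yn Y \<longleftrightarrow>
     closed Y \<and> (\<forall>y. (\<lambda>\<nu>. infdist y (Yn \<nu>)) \<longlonglongrightarrow> infdist y Y)"

text \<open>The filter for limits along an infinite set \<open>N\<close> of indices.\<close>

abbreviation along :: "nat set \<Rightarrow> nat filter" where
  "along N \<equiv> inf sequentially (principal N)"

text \<open>All infima below are taken in \<open>ereal\<close>, where the infimum of the empty set is \<open>\<infinity>\<close>.\<close>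

definition tau_argmin :: "real \<Rightarrow> ('b \<Rightarrow> real) \<Rightarrow> 'b set \<Rightarrow> 'b set" where
  "tau_argmin \<tau> \<phi> S = {y \<in> S. ereal (\<phi> y) \<le> (INF z\<in>S. ereal (\<phi> z)) + ereal \<tau>}"

definition P_feasible ::
  "'a set \<Rightarrow> 'b set \<Rightarrow> 'c set \<Rightarrow> ('a \<Rightarrow> 'b \<Rightarrow> real) \<Rightarrow> ('a \<Rightarrow> 'b \<Rightarrow> 'c) \<Rightarrow> real \<Rightarrow> ('a \<times> 'b) set" where
  "P_feasible X Y D g H \<tau> =
     {(x, y). x \<in> X \<and> y \<in> tau_argmin \<tau> (g x) {z \<in> Y. H x z \<in> D}}"

definition P_min ::
  "'a set \<Rightarrow> 'b set \<Rightarrow> 'c set \<Rightarrow> ('a \<Rightarrow> 'b \<Rightarrow> ereal) \<Rightarrow> ('a \<Rightarrow> 'b \<Rightarrow> real) \<Rightarrow> ('a \<Rightarrow> 'b \<Rightarrow> 'c)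
    \<Rightarrow> real \<Rightarrow> ereal" where
  "P_min X Y D f g H \<tau> = (INF (x, y)\<in>P_feasible X Y D g H \<tau>. f x y)"

definition P_optimal ::
  "'a set \<Rightarrow> 'b set \<Rightarrow> 'c set \<Rightarrow> ('a \<Rightarrow> 'b \<Rightarrow> ereal) \<Rightarrow> ('a \<Rightarrow> 'b \<Rightarrow> real) \<Rightarrow> ('a \<Rightarrow> 'b \<Rightarrow> 'c)
    \<Rightarrow> real \<Rightarrow> 'a \<Rightarrow> 'b \<Rightarrow> bool" where
  "P_optimal X Y D f g H \<tau> x y \<longleftrightarrow>
     (x, y) \<in> P_feasible X Y D g H \<tau> \<and> f x y < \<infinity> \<and> f x y \<le> P_min X Y D f g H \<tau>"

definition value_fun ::
  "'b set \<Rightarrow> ('c::real_vector) set \<Rightarrow> ('a \<Rightarrow> 'b \<Rightarrow> real) \<Rightarrow> ('a \<Rightarrow> 'b \<Rightarrow> 'c) \<Rightarrow> 'a \<Rightarrow> 'c \<Rightarrow> ereal" where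
  "value_fun Y D g H x u = (INF y\<in>{y \<in> Y. H x y + u \<in> D}. ereal (g x y))"

definition penalty_threshold ::
  "('c::real_vector \<Rightarrow> real) \<Rightarrow> ('a \<Rightarrow> 'c \<Rightarrow> ereal) \<Rightarrow> 'a \<Rightarrow> real \<Rightarrow> bool" where
  "penalty_threshold nrm V x l \<longleftrightarrow>
     0 \<le> l \<and> (\<forall>u. V x u \<ge> V x 0 - ereal (l * nrm u))"

definition calm_at :: "('c::real_vector \<Rightarrow> real) \<Rightarrow> ('a \<Rightarrow> 'c \<Rightarrow> ereal) \<Rightarrow> 'a \<Rightarrow> bool" where
  "calm_at nrm V x \<longleftrightarrow> (\<exists>l. penalty_threshold nrm V x l)"

text \<open>The approximating problem: points are \<open>(x, y, u, \<alpha>, \<lambda>)\<close>. In \<open>Pn_feasible\<close>, \<open>Yn\<close>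
  indexes the lower-level constraints, whereas \<open>y\<close> itself ranges over \<open>Y\<close>.\<close>

definition Pn_feasible ::
  "('c::real_vector \<Rightarrow> real) \<Rightarrow> 'a set \<Rightarrow> 'b set \<Rightarrow> 'b set \<Rightarrow> 'c set
    \<Rightarrow> ('a \<Rightarrow> 'b \<Rightarrow> real) \<Rightarrow> ('a \<Rightarrow> 'b \<Rightarrow> 'c) \<Rightarrow> real \<Rightarrow> real
    \<Rightarrow> ('a \<times> 'b \<times> 'c \<times> real \<times> real) set" where
  "Pn_feasible nrm X Y Yn D gn Hn lbar \<tau>n =
     {(x, y, u, \<alpha>, l).
        Hn x y + u \<in> D \<and>
        (\<forall>z\<in>Yn. gn x y + \<alpha> \<le> gn x z + l * nrm_dist nrm (Hn x z) D + \<tau>n) \<and>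
        x \<in> X \<and> y \<in> Y \<and> \<alpha> \<le> 0 \<and> 0 \<le> l \<and> l \<le> lbar}"

definition Pn_objective ::
  "('c \<Rightarrow> real) \<Rightarrow> ('a \<Rightarrow> 'b \<Rightarrow> ereal) \<Rightarrow> real \<Rightarrow> real
    \<Rightarrow> ('a \<times> 'b \<times> 'c \<times> real \<times> real) \<Rightarrow> ereal" where
  "Pn_objective nrm fn \<sigma> \<theta> = (\<lambda>(x, y, u, \<alpha>, l). fn x y + ereal (\<sigma> * nrm u) - ereal (\<theta> * \<alpha>))"

definition Pn_min ::
  "('c::real_vector \<Rightarrow> real) \<Rightarrow> 'a set \<Rightarrow> 'b set \<Rightarrow> 'b set \<Rightarrow> 'c set
    \<Rightarrow> ('a \<Rightarrow> 'b \<Rightarrow> ereal) \<Rightarrow> ('a \<Rightarrow> 'b \<Rightarrow> real) \<Rightarrow> ('a \<Rightarrow> 'b \<Rightarrow> 'c)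
    \<Rightarrow> real \<Rightarrow> real \<Rightarrow> real \<Rightarrow> real \<Rightarrow> ereal" where
  "Pn_min nrm X Y Yn D fn gn Hn \<sigma> \<theta> lbar \<tau>n =
     (INF w\<in>Pn_feasible nrm X Y Yn D gn Hn lbar \<tau>n. Pn_objective nrm fn \<sigma> \<theta> w)"

definition Pn_eps_optimal ::
  "('c::real_vector \<Rightarrow> real) \<Rightarrow> 'a set \<Rightarrow> 'b set \<Rightarrow> 'b set \<Rightarrow> 'c set
    \<Rightarrow> ('a \<Rightarrow> 'b \<Rightarrow> ereal) \<Rightarrow> ('a \<Rightarrow> 'b \<Rightarrow> real) \<Rightarrow> ('a \<Rightarrow> 'b \<Rightarrow> 'c)
    \<Rightarrow> real \<Rightarrow> real \<Rightarrow> real \<Rightarrow> real \<Rightarrow> real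
    \<Rightarrow> ('a \<times> 'b \<times> 'c \<times> real \<times> real) \<Rightarrow> bool" where
  "Pn_eps_optimal nrm X Y Yn D fn gn Hn \<sigma> \<theta> lbar \<tau>n \<epsilon> w \<longleftrightarrow>
     w \<in> Pn_feasible nrm X Y Yn D gn Hn lbar \<tau>n \<and>
     \<bar>Pn_objective nrm fn \<sigma> \<theta> w\<bar> \<noteq> \<infinity> \<and>
     Pn_objective nrm fn \<sigma> \<theta> w \<le> Pn_min nrm X Y Yn D fn gn Hn \<sigma> \<theta> lbar \<tau>n + ereal \<epsilon>"

abbreviation Pn_optimal ::
  "('c::real_vector \<Rightarrow> real) \<Rightarrow> 'a set \<Rightarrow> 'b set \<Rightarrow> 'b set \<Rightarrow> 'c set
    \<Rightarrow> ('a \<Rightarrow> 'b \<Rightarrow> ereal) \<Rightarrow> ('a \<Rightarrow> 'b \<Rightarrow> real) \<Rightarrow> ('a \<Rightarrow> 'b \<Rightarrow> 'c)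
    \<Rightarrow> real \<Rightarrow> real \<Rightarrow> real \<Rightarrow> real
    \<Rightarrow> ('a \<times> 'b \<times> 'c \<times> real \<times> real) \<Rightarrow> bool" where
  "Pn_optimal nrm X Y Yn D fn gn Hn \<sigma> \<theta> lbar \<tau>n w \<equiv>
     Pn_eps_optimal nrm X Y Yn D fn gn Hn \<sigma> \<theta> lbar \<tau>n 0 w"

end

theory Submission
  imports Defs
begin

text \<open>Calmness of \<open>V\<close> at \<open>xstar\<close> turns lower-level optimality of \<open>ystar\<close> into the exact penalty inequality
  \<open>g xstar ystar \<le> g xstar z + \<lambda> * dist (H xstar z) D + \<tau>\<close> for all \<open>z \<in> Y\<close>. Hence \<open>(xstar, ystar)\<close> extends, with small
  \<open>u\<close> and \<open>\<alpha>\<close>, to feasible points of the approximating problems whose objective values have upper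
  limit at most \<open>f xstar ystar\<close>; this is (a). Conversely, along near-optimal points that converge, the
  objective values stay bounded while \<open>\<sigma>, \<theta> \<rightarrow> \<infinity>\<close>, which forces \<open>u\<close> and \<open>\<alpha>\<close> to 0, and the
  constraints pass to the limit when tested against \<open>zs \<nu> \<in> Yn \<nu>\<close> with \<open>zs \<nu> \<rightarrow> z\<close>; this is (c). In (b),
  compactness and (c) give convergence of the minimum values, so that the points constructed for (a)
  are near-optimal.\<close>

section \<open>Arbitrary norms and the distances they induce\<close>

lemma is_norm_minus: "is_norm nrm \<Longrightarrow> nrm (- a) = nrm a"
  unfolding is_norm_def by (metis abs_1 abs_minus mult_1 scaleR_minus1_left)

lemma is_norm_minus_commute: "is_norm nrm \<Longrightarrow> nrm (a - b) = nrm (b - a)"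
  using is_norm_minus[of nrm "a - b"] by simp

lemma is_norm_diff_triangle:
  assumes "is_norm nrm" shows "nrm (a - c) \<le> nrm (a - b) + nrm (b - c)"
proof -
  have "nrm ((a - b) + (b - c)) \<le> nrm (a - b) + nrm (b - c)"
    using assms unfolding is_norm_def by blast
  then show ?thesis by simp
qed

lemma nrm_dist_le:
  assumes "is_norm nrm" "b \<in> D"
  shows "nrm_dist nrm a D \<le> nrm (a - b)"
  unfolding nrm_dist_def
proof (rule cINF_lower)
  show "bdd_below ((\<lambda>b. nrm (a - b)) ` D)"
    using assms(1) by (intro bdd_belowI[of _ 0]) (auto simp: is_norm_def)
qed fact

lemma nrm_dist_nonneg:
  assumes "is_norm nrm" "D \<noteq> {}"
  shows "0 \<le> nrm_dist nrm a D"
  unfolding nrm_dist_def using assms by (intro cINF_greatest) (auto simp: is_norm_def)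

text \<open>Near-minimizers come straight from the infimum; working with them avoids any appeal to
  nearest points of \<open>D\<close>.\<close>

lemma nrm_dist_approx:
  assumes "D \<noteq> {}" "0 < e"
  obtains b where "b \<in> D" "nrm (a - b) < nrm_dist nrm a D + e"
proof -
  have "(INF b\<in>D. nrm (a - b)) < nrm_dist nrm a D + e"
    using assms(2) by (simp add: nrm_dist_def)
  then obtain c where "c \<in> (\<lambda>b. nrm (a - b)) ` D" "c < nrm_dist nrm a D + e"
    using assms(1) cInf_lessD[of "(\<lambda>b. nrm (a - b)) ` D"] by blast
  then show ?thesis using that by blast
qed

lemma nrm_dist_triangle:
  assumes "is_norm nrm" "D \<noteq> {}"
  shows "nrm_dist nrm a D \<le> nrm (a - b) + nrm_dist nrm b D"
proof (rule field_le_epsilon)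
  fix e :: real assume "0 < e"
  then obtain c where c: "c \<in> D" "nrm (b - c) < nrm_dist nrm b D + e"
    using nrm_dist_approx[OF assms(2)] by metis
  show "nrm_dist nrm a D \<le> nrm (a - b) + nrm_dist nrm b D + e"
    using nrm_dist_le[OF assms(1) c(1), of a] is_norm_diff_triangle[OF assms(1), of a c b] c(2)
    by linarith
qed

text \<open>Expanding \<open>a\<close> in the orthonormal basis and using subadditivity gives the
  constant \<open>S\<close>. The bound makes \<open>nrm\<close> continuous for the Euclidean
  topology, in which all limits are taken.\<close>

lemma is_norm_bounded_above:
  fixes nrm :: "'a::euclidean_space \<Rightarrow> real"
  assumes "is_norm nrm"
  obtains C where "0 < C" "\<And>a. nrm a \<le> C * norm a"
proof -
  define S where "S = (\<Sum>b\<in>Basis. nrm b)"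
  have nn: "0 \<le> nrm a" and scale: "nrm (c *\<^sub>R a) = \<bar>c\<bar> * nrm a"
    and tri: "nrm (a + b) \<le> nrm a + nrm b" and zero: "nrm 0 = 0" for a b c
    using assms by (auto simp: is_norm_def)
  have sum: "nrm (\<Sum>b\<in>I. h b) \<le> (\<Sum>b\<in>I. nrm (h b))" if "finite I" for I and h :: "'a \<Rightarrow> 'a"
    using that by (induction I) (auto simp: zero intro: order_trans[OF tri])
  have le: "nrm a \<le> S * norm a" for a
  proof -
    have "nrm a = nrm (\<Sum>b\<in>Basis. (a \<bullet> b) *\<^sub>R b)" by (simp add: euclidean_representation)
    also have "\<dots> \<le> (\<Sum>b\<in>Basis. \<bar>a \<bullet> b\<bar> * nrm b)"
      using sum[OF finite_Basis, of "\<lambda>b. (a \<bullet> b) *\<^sub>R b"] by (simp add: scale)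
    also have "\<dots> \<le> (\<Sum>b\<in>Basis. norm a * nrm b)"
      by (intro sum_mono mult_right_mono Basis_le_norm nn)
    also have "\<dots> = S * norm a" by (simp add: S_def sum_distrib_left mult.commute)
    finally show ?thesis .
  qed
  have S: "0 \<le> S" unfolding S_def by (intro sum_nonneg nn)
  have "nrm a \<le> (S + 1) * norm a" for a
    using le[of a] norm_ge_zero[of a] by (simp add: algebra_simps del: norm_ge_zero)
  then show ?thesis using S by (intro that[of "S + 1"]) auto
qed

lemma is_norm_tendsto:
  fixes nrm :: "'a::euclidean_space \<Rightarrow> real"
  assumes "is_norm nrm" "(h \<longlongrightarrow> a) F"
  shows "((\<lambda>i. nrm (h i - a)) \<longlongrightarrow> 0) F"
proof -
  obtain C where C: "0 < C" "\<And>a. nrm a \<le> C * norm a"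
    using is_norm_bounded_above[OF assms(1)] by blast
  have lim: "((\<lambda>i. C * norm (h i - a)) \<longlongrightarrow> 0) F"
    using tendsto_mult_left[OF tendsto_norm_zero[OF LIM_zero[OF assms(2)]], of C] by simp
  show ?thesis
    by (rule tendsto_sandwich[OF _ _ tendsto_const lim])
       (use assms(1) C(2) in \<open>auto simp: is_norm_def\<close>)
qed

lemma is_norm_continuous_on:
  fixes nrm :: "'a::euclidean_space \<Rightarrow> real"
  assumes "is_norm nrm"
  shows "continuous_on S nrm"
  unfolding continuous_on_def
proof
  fix a
  have tri: "nrm (b + c) \<le> nrm b + nrm c" for b c using assms by (auto simp: is_norm_def)
  have "\<bar>nrm b - nrm a\<bar> \<le> nrm (b - a)" for b
    using tri[of "b - a" a] tri[of "a - b" b] is_norm_minus_commute[OF assms, of a b] by simp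
  then have "((\<lambda>b. nrm b - nrm a) \<longlongrightarrow> 0) (at a within S)"
    by (intro Lim_null_comparison[OF _ is_norm_tendsto[OF assms tendsto_ident_at]]) simp
  then show "(nrm \<longlongrightarrow> nrm a) (at a within S)" by (rule LIM_zero_cancel)
qed

text \<open>\<open>nrm\<close> attains its minimum on the compact unit sphere, where definiteness
  makes it positive; homogeneity carries the bound to all vectors. This turns convergence in
  \<open>nrm\<close> into Euclidean convergence.\<close>

lemma is_norm_bounded_below:
  fixes nrm :: "'a::euclidean_space \<Rightarrow> real"
  assumes "is_norm nrm"
  obtains c where "0 < c" "\<And>a. c * norm a \<le> nrm a"
proof -
  have ne: "sphere (0::'a) 1 \<noteq> {}" by simp
  obtain s where s: "s \<in> sphere 0 1" "\<And>a. a \<in> sphere 0 1 \<Longrightarrow> nrm s \<le> nrm a"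
    using continuous_attains_inf[OF compact_sphere ne is_norm_continuous_on[OF assms]] by blast
  have "s \<noteq> 0" using s(1) by auto
  then have "0 < nrm s" using assms by (metis is_norm_def order_le_less)
  moreover have "nrm s * norm a \<le> nrm a" for a
  proof (cases "a = 0")
    case True then show ?thesis using assms by (simp add: is_norm_def)
  next
    case False
    have "nrm s \<le> nrm ((1 / norm a) *\<^sub>R a)" using False by (intro s(2)) simp
    also have "\<dots> = \<bar>1 / norm a\<bar> * nrm a" using assms unfolding is_norm_def by blast
    finally show ?thesis using False by (simp add: field_simps)
  qed
  ultimately show ?thesis using that by blast
qed

lemma is_norm_tendsto_zeroD:
  fixes nrm :: "'a::euclidean_space \<Rightarrow> real"
  assumes "is_norm nrm" "((\<lambda>i. nrm (h i)) \<longlongrightarrow> 0) F"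
  shows "(h \<longlongrightarrow> 0) F"
proof -
  obtain c where c: "0 < c" "\<And>a. c * norm a \<le> nrm a"
    using is_norm_bounded_below[OF assms(1)] by blast
  have lim: "((\<lambda>i. nrm (h i) / c) \<longlongrightarrow> 0) F"
    using tendsto_divide[OF assms(2) tendsto_const, of c] c(1) by simp
  show ?thesis
    by (rule Lim_null_comparison[OF _ lim]) (use c in \<open>simp add: field_simps\<close>)
qed

text \<open>The triangle inequality makes the distance to \<open>D\<close> 1-Lipschitz for
  \<open>nrm\<close>.\<close>

lemma tendsto_nrm_dist:
  fixes nrm :: "'a::euclidean_space \<Rightarrow> real"
  assumes "is_norm nrm" "D \<noteq> {}" "(h \<longlongrightarrow> a) F"
  shows "((\<lambda>i. nrm_dist nrm (h i) D) \<longlongrightarrow> nrm_dist nrm a D) F"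
proof -
  have "\<bar>nrm_dist nrm b D - nrm_dist nrm a D\<bar> \<le> nrm (b - a)" for b
    using nrm_dist_triangle[OF assms(1,2), of a b] nrm_dist_triangle[OF assms(1,2), of b a]
      is_norm_minus_commute[OF assms(1), of a b] by linarith
  then have "((\<lambda>i. nrm_dist nrm (h i) D - nrm_dist nrm a D) \<longlongrightarrow> 0) F"
    by (intro Lim_null_comparison[OF _ is_norm_tendsto[OF assms(1,3)]]) simp
  then show ?thesis by (rule LIM_zero_cancel)
qed

lemma nrm_dist_eq_zero_iff:
  fixes nrm :: "'a::euclidean_space \<Rightarrow> real"
  assumes nrm: "is_norm nrm" and D: "D \<noteq> {}" "closed D"
  shows "nrm_dist nrm a D = 0 \<longleftrightarrow> a \<in> D"
proof
  assume "a \<in> D"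
  then show "nrm_dist nrm a D = 0"
    using nrm_dist_le[OF nrm, of a D a] nrm_dist_nonneg[OF nrm D(1), of a] nrm
    unfolding is_norm_def by (metis diff_self order_antisym)
next
  assume 0: "nrm_dist nrm a D = 0"
  obtain c where c: "0 < c" "\<And>a. c * norm a \<le> nrm a"
    using is_norm_bounded_below[OF nrm] by blast
  \<comment> \<open>The tolerance \<open>c * e\<close> in \<open>nrm\<close> becomes
    \<open>e\<close> in the Euclidean distance, which puts \<open>a\<close> in the closure of
    \<open>D\<close>.\<close>
  have "\<exists>b\<in>D. dist b a < e" if "0 < e" for e
  proof -
    have "0 < c * e" using c(1) that by simp
    then obtain b where b: "b \<in> D" "nrm (a - b) < c * e"
      using nrm_dist_approx[OF D(1), of _ nrm a] 0 by force
    then have "c * norm (a - b) < c * e" using c(2)[of "a - b"] by linarith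
    then show ?thesis using b(1) c(1) by (auto simp: dist_norm norm_minus_commute)
  qed
  then show "a \<in> D" using D(2) closure_approachable[of a D] by (simp add: closure_closed)
qed

section \<open>Set convergence, limits along subsequences, and exact penalization\<close>

text \<open>Since \<open>infdist z Y = 0\<close>, the distances from \<open>z\<close> to
  \<open>Yn \<nu>\<close> vanish; near-minimizers with tolerance \<open>inverse (Suc \<nu>)\<close>
  then converge to \<open>z\<close>.\<close>

lemma PK_converges_recovery:
  assumes "PK_converges Yn Y" "\<And>\<nu>. Yn \<nu> \<noteq> {}" "z \<in> Y"
  obtains zs where "\<And>\<nu>. zs \<nu> \<in> Yn \<nu>" "zs \<longlonglongrightarrow> z"
proof -
  have "\<exists>y\<in>Yn \<nu>. dist z y < infdist z (Yn \<nu>) + inverse (Suc \<nu>)" for \<nu>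
  proof -
    have "(INF y\<in>Yn \<nu>. dist z y) < infdist z (Yn \<nu>) + inverse (Suc \<nu>)"
      using assms(2) by (simp add: infdist_notempty)
    then show ?thesis
      using assms(2) cInf_lessD[of "dist z ` Yn \<nu>"] by blast
  qed
  then obtain zs where zs: "\<And>\<nu>. zs \<nu> \<in> Yn \<nu>"
    "\<And>\<nu>. dist z (zs \<nu>) < infdist z (Yn \<nu>) + inverse (Suc \<nu>)" by metis
  have "(\<lambda>\<nu>. infdist z (Yn \<nu>) + inverse (Suc \<nu>)) \<longlonglongrightarrow> infdist z Y + 0"
    using assms(1) by (intro tendsto_add LIMSEQ_inverse_real_of_nat) (simp add: PK_converges_def)
  then have lim: "(\<lambda>\<nu>. infdist z (Yn \<nu>) + inverse (Suc \<nu>)) \<longlonglongrightarrow> 0"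
    using assms(3) by simp
  have "(\<lambda>\<nu>. dist (zs \<nu>) z) \<longlonglongrightarrow> 0"
    by (rule tendsto_sandwich[OF _ _ tendsto_const lim])
       (use zs(2) in \<open>auto simp: dist_commute intro!: always_eventually less_imp_le\<close>)
  then have "zs \<longlonglongrightarrow> z" using tendsto_dist_iff by blast
  with zs(1) show ?thesis using that by blast
qed

lemma along_neq_bot: "infinite N \<Longrightarrow> along N \<noteq> bot"
  unfolding trivial_limit_def eventually_inf_principal eventually_sequentially
  by (auto simp: infinite_nat_iff_unbounded_le)

text \<open>The lower-limit condition on \<open>fn\<close> concerns full sequences. Filling the
  indices outside \<open>N\<close> with the limit produces one.\<close>

lemma tendsto_along_extend:
  assumes "(h \<longlongrightarrow> a) (along N)"
  shows "(\<lambda>\<nu>. if \<nu> \<in> N then h \<nu> else a) \<longlonglongrightarrow> a"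
  using assms unfolding tendsto_def eventually_inf_principal
  by (auto elim!: eventually_mono)

text \<open>Links the subsequences that compactness provides with the filter \<open>along\<close>.
  Strict monotonicity makes \<open>s n0\<close> a valid threshold: \<open>s n \<ge> s n0\<close>
  forces \<open>n \<ge> n0\<close>.\<close>

lemma tendsto_along_range:
  assumes "strict_mono (s :: nat \<Rightarrow> nat)" "(h \<circ> s) \<longlonglongrightarrow> a"
  shows "(h \<longlongrightarrow> a) (along (range s))"
  unfolding tendsto_def eventually_inf_principal
proof (intro allI impI)
  fix S assume "open S" "a \<in> S"
  with assms(2) obtain n0 where n0: "\<And>n. n0 \<le> n \<Longrightarrow> h (s n) \<in> S"
    unfolding tendsto_def eventually_sequentially o_def by blast
  show "\<forall>\<^sub>F \<nu> in sequentially. \<nu> \<in> range s \<longrightarrow> h \<nu> \<in> S"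
    unfolding eventually_sequentially
    using n0 strict_mono_less_eq[OF assms(1)] by (intro exI[of _ "s n0"]) auto
qed

text \<open>Calmness makes the distance penalty exact: perturbing by \<open>u = b - H x z\<close> with \<open>b \<in> D\<close>
  turns any \<open>z\<close> into a point that is feasible for the perturbed lower-level problem.\<close>

lemma penalty_threshold_exact:
  assumes nrm: "is_norm nrm" and D: "D \<noteq> {}"
    and thr: "penalty_threshold nrm (value_fun Y D g H) x l0" and l: "l0 \<le> l"
    and y: "y \<in> tau_argmin \<tau> (g x) {z \<in> Y. H x z \<in> D}" and z: "z \<in> Y"
  shows "g x y \<le> g x z + l * nrm_dist nrm (H x z) D + \<tau>"
proof -
  let ?V = "value_fun Y D g H"
  \<comment> \<open>The two bounds sandwich the value at zero perturbation, so it is a real number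
    \<open>v\<close>.\<close>
  have V0: "ereal (g x y) \<le> ?V x 0 + ereal \<tau>" "?V x 0 \<le> ereal (g x y)"
    using y unfolding tau_argmin_def value_fun_def by (auto intro!: INF_lower2[of y])
  then obtain v where v: "?V x 0 = ereal v" by (cases "?V x 0") auto
  have l0: "0 \<le> l0" using thr by (simp add: penalty_threshold_def)
  have *: "v \<le> g x z + l0 * nrm (H x z - b)" if b: "b \<in> D" for b
  proof -
    have "?V x 0 - ereal (l0 * nrm (b - H x z)) \<le> ?V x (b - H x z)"
      using thr by (simp add: penalty_threshold_def)
    also have "\<dots> \<le> ereal (g x z)"
      unfolding value_fun_def using z b by (intro INF_lower) simp
    finally show ?thesis using v is_norm_minus_commute[OF nrm, of b "H x z"] by simp
  qed
  have "v \<le> g x z + l0 * nrm_dist nrm (H x z) D"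
  proof (rule field_le_epsilon)
    fix e :: real assume e: "0 < e"
    \<comment> \<open>The divisor \<open>l0 + 1\<close> is positive even for \<open>l0 = 0\<close>,
      and multiplication by \<open>l0\<close> leaves an error of at most \<open>e\<close>.\<close>
    then have "0 < e / (l0 + 1)" using l0 by simp
    then obtain b where b: "b \<in> D" "nrm (H x z - b) < nrm_dist nrm (H x z) D + e / (l0 + 1)"
      by (rule nrm_dist_approx[OF D])
    have "l0 * nrm (H x z - b) \<le> l0 * (nrm_dist nrm (H x z) D + e / (l0 + 1))"
      using b(2) l0 by (intro mult_left_mono) auto
    also have "\<dots> \<le> l0 * nrm_dist nrm (H x z) D + e"
      using l0 e by (simp add: field_simps)
    finally show "v \<le> g x z + l0 * nrm_dist nrm (H x z) D + e" using *[OF b(1)] by linarith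
  qed
  moreover have "l0 * nrm_dist nrm (H x z) D \<le> l * nrm_dist nrm (H x z) D"
    by (intro mult_right_mono l nrm_dist_nonneg[OF nrm D])
  moreover have "g x y \<le> v + \<tau>" using V0(1) v by simp
  ultimately show ?thesis by linarith
qed

section \<open>The approximation setting\<close>

text \<open>The supremum bounds on the errors of \<open>gn\<close> and \<open>Hn\<close> appear
  pointwise, the form in which the limits use them. A calm optimal solution is fixed along with the
  data.\<close>

locale bilevel_approximation =
  fixes nrm :: "'c::euclidean_space \<Rightarrow> real"
    and X :: "'a::euclidean_space set" and Y :: "'b::euclidean_space set" and D :: "'c set"
    and Yn :: "nat \<Rightarrow> 'b set"
    and f :: "'a \<Rightarrow> 'b \<Rightarrow> ereal" and fn :: "nat \<Rightarrow> 'a \<Rightarrow> 'b \<Rightarrow> ereal"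
    and g :: "'a \<Rightarrow> 'b \<Rightarrow> real" and gn :: "nat \<Rightarrow> 'a \<Rightarrow> 'b \<Rightarrow> real"
    and H :: "'a \<Rightarrow> 'b \<Rightarrow> 'c" and Hn :: "nat \<Rightarrow> 'a \<Rightarrow> 'b \<Rightarrow> 'c"
    and \<sigma> \<theta> lbar \<tau>n \<delta> \<eta> :: "nat \<Rightarrow> real" and \<tau> :: real
    and xstar :: 'a and ystar :: 'b
  assumes nrm: "is_norm nrm"
    and X: "closed X" and Y: "closed Y" and D: "D \<noteq> {}" "closed D"
    and Yn: "\<And>\<nu>. Yn \<nu> \<noteq> {}" "\<And>\<nu>. Yn \<nu> \<subseteq> Y" "PK_converges Yn Y"
    and \<delta>: "\<delta> \<longlonglongrightarrow> 0"
    and gn: "\<And>\<nu> x y. x \<in> X \<Longrightarrow> y \<in> Y \<Longrightarrow> \<bar>gn \<nu> x y - g x y\<bar> \<le> \<delta> \<nu>"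
    and g: "continuous_on (X \<times> Y) (\<lambda>(x, y). g x y)"
    and \<eta>: "\<eta> \<longlonglongrightarrow> 0"
    and Hn: "\<And>\<nu> x y. x \<in> X \<Longrightarrow> y \<in> Y \<Longrightarrow>
      \<bar>nrm_dist nrm (Hn \<nu> x y) D - nrm_dist nrm (H x y) D\<bar> \<le> \<eta> \<nu>"
    and H: "continuous_on (X \<times> Y) (\<lambda>(x, y). H x y)"
    and f_ran: "\<And>x y. f x y \<noteq> -\<infinity>" "\<And>\<nu> x y. fn \<nu> x y \<noteq> -\<infinity>"
    and limsup_fn: "\<And>x y. x \<in> X \<Longrightarrow> y \<in> Y \<Longrightarrow> limsup (\<lambda>\<nu>. fn \<nu> x y) \<le> f x y"
    and liminf_fn: "\<And>x y xs ys. x \<in> X \<Longrightarrow> y \<in> Y \<Longrightarrow> (\<And>\<nu>. xs \<nu> \<in> X) \<Longrightarrow> xs \<longlonglongrightarrow> x \<Longrightarrow>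
         (\<And>\<nu>. ys \<nu> \<in> Y) \<Longrightarrow> ys \<longlonglongrightarrow> y \<Longrightarrow> liminf (\<lambda>\<nu>. fn \<nu> (xs \<nu>) (ys \<nu>)) \<ge> f x y"
    and \<sigma>_nonneg: "\<And>\<nu>. 0 \<le> \<sigma> \<nu>" and \<theta>_nonneg: "\<And>\<nu>. 0 \<le> \<theta> \<nu>"
    and lbar: "filterlim lbar at_top sequentially"
    and \<sigma>\<eta>: "(\<lambda>\<nu>. \<sigma> \<nu> * \<eta> \<nu>) \<longlonglongrightarrow> 0"
    and \<theta>\<eta>: "(\<lambda>\<nu>. \<theta> \<nu> * lbar \<nu> * \<eta> \<nu>) \<longlonglongrightarrow> 0"
    and \<theta>\<delta>: "(\<lambda>\<nu>. \<theta> \<nu> * \<delta> \<nu>) \<longlonglongrightarrow> 0"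
    and \<theta>\<tau>: "(\<lambda>\<nu>. \<theta> \<nu> * \<bar>\<tau>n \<nu> - \<tau>\<bar>) \<longlonglongrightarrow> 0"
    and opt: "P_optimal X Y D f g H \<tau> xstar ystar"
    and calm: "calm_at nrm (value_fun Y D g H) xstar"
begin

abbreviation "m \<equiv> P_min X Y D f g H \<tau>"
abbreviation "mn \<nu> \<equiv>
  Pn_min nrm X Y (Yn \<nu>) D (fn \<nu>) (gn \<nu>) (Hn \<nu>) (\<sigma> \<nu>) (\<theta> \<nu>) (lbar \<nu>) (\<tau>n \<nu>)"
abbreviation "feas \<nu> \<equiv> Pn_feasible nrm X Y (Yn \<nu>) D (gn \<nu>) (Hn \<nu>) (lbar \<nu>) (\<tau>n \<nu>)"
abbreviation "obj \<nu> \<equiv> Pn_objective nrm (fn \<nu>) (\<sigma> \<nu>) (\<theta> \<nu>)"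
abbreviation "eps_opt \<nu> \<equiv> Pn_eps_optimal nrm X Y (Yn \<nu>) D (fn \<nu>) (gn \<nu>) (Hn \<nu>)
  (\<sigma> \<nu>) (\<theta> \<nu>) (lbar \<nu>) (\<tau>n \<nu>)"
abbreviation "dD a \<equiv> nrm_dist nrm a D"

lemma obj_eq: "obj \<nu> (x, y, u, \<alpha>, l) = fn \<nu> x y + ereal (\<sigma> \<nu> * nrm u - \<theta> \<nu> * \<alpha>)"
  by (cases "fn \<nu> x y") (auto simp: Pn_objective_def)

lemma nrm_nonneg: "0 \<le> nrm a"
  using nrm by (simp add: is_norm_def)

text \<open>The optimal solution is feasible, so \<open>m\<close> equals its value; that value is
  below \<open>\<infinity>\<close> by optimality, and \<open>f\<close> never takes
  \<open>-\<infinity>\<close>.\<close>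

lemma star:
  shows "xstar \<in> X" "ystar \<in> Y" "H xstar ystar \<in> D" "f xstar ystar = m" "\<bar>m\<bar> \<noteq> \<infinity>"
    "ystar \<in> tau_argmin \<tau> (g xstar) {z \<in> Y. H xstar z \<in> D}"
proof -
  have feas: "(xstar, ystar) \<in> P_feasible X Y D g H \<tau>"
    and f: "f xstar ystar < \<infinity>" "f xstar ystar \<le> m"
    using opt by (auto simp: P_optimal_def)
  show "ystar \<in> tau_argmin \<tau> (g xstar) {z \<in> Y. H xstar z \<in> D}"
    "xstar \<in> X" "ystar \<in> Y" "H xstar ystar \<in> D"
    using feas by (auto simp: P_feasible_def tau_argmin_def)
  have "m \<le> f xstar ystar" unfolding P_min_def by (rule INF_lower2[OF feas]) simp
  with f(2) show "f xstar ystar = m" by simp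
  then show "\<bar>m\<bar> \<noteq> \<infinity>" using f(1) f_ran(1)[of xstar ystar] by (cases m) auto
qed

lemma \<delta>_nonneg: "0 \<le> \<delta> \<nu>" and \<eta>_nonneg: "0 \<le> \<eta> \<nu>"
  using gn[OF star(1,2), of \<nu>] Hn[OF star(1,2), of \<nu>] by linarith+

lemma mn_le: "w \<in> feas \<nu> \<Longrightarrow> mn \<nu> \<le> obj \<nu> w"
  unfolding Pn_min_def by (rule INF_lower)

section \<open>Recovery points and the upper bound on the minimum values\<close>

text \<open>Once \<open>\<theta> \<nu>\<close> is at least \<open>c\<close>, the weighted error
  divided by \<open>c\<close> dominates the error of \<open>\<tau>n\<close>.\<close>

lemma \<tau>n_tendsto:
  assumes "0 < c" "\<forall>\<^sub>F \<nu> in sequentially. c \<le> \<theta> \<nu>"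
  shows "\<tau>n \<longlonglongrightarrow> \<tau>"
proof -
  have lim: "(\<lambda>\<nu>. \<theta> \<nu> * \<bar>\<tau>n \<nu> - \<tau>\<bar> / c) \<longlonglongrightarrow> 0"
    using tendsto_divide[OF \<theta>\<tau> tendsto_const, of c] assms(1) by simp
  have "(\<lambda>\<nu>. \<tau>n \<nu> - \<tau>) \<longlonglongrightarrow> 0"
    by (rule Lim_null_comparison[OF _ lim])
       (use assms in \<open>auto elim!: eventually_mono simp: field_simps mult_right_mono\<close>)
  then show ?thesis by (rule LIM_zero_cancel)
qed

text \<open>The slack \<open>\<alpha> \<nu>\<close> collects the errors made when \<open>g\<close>, \<open>H\<close>, \<open>\<tau>\<close> are replaced by their
  approximations in the exact penalty inequality; (A6) makes its cost \<open>\<theta> \<nu> * \<alpha> \<nu>\<close> vanish.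
  The term \<open>1 / Suc \<nu>\<close> below compensates for not choosing a nearest point of \<open>D\<close>.\<close>

lemma recovery_sequence:
  assumes thr: "penalty_threshold nrm (value_fun Y D g H) xstar l0" and l: "l0 \<le> l"
  obtains u \<alpha> where
    "\<forall>\<^sub>F \<nu> in sequentially. (xstar, ystar, u \<nu>, \<alpha> \<nu>, l) \<in> feas \<nu>"
    "(\<lambda>\<nu>. \<sigma> \<nu> * nrm (u \<nu>) - \<theta> \<nu> * \<alpha> \<nu>) \<longlonglongrightarrow> 0"
    "u \<longlonglongrightarrow> 0" "\<tau>n \<longlonglongrightarrow> \<tau> \<Longrightarrow> \<alpha> \<longlonglongrightarrow> 0"
proof -
  \<comment> \<open>\<open>2 * \<delta> \<nu>\<close> pays for replacing \<open>g\<close> at both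
    \<open>ystar\<close> and \<open>z\<close>, \<open>l * \<eta> \<nu>\<close> for the distance at
    \<open>z\<close>, and the last term for the tolerance.\<close>
  define \<alpha> where "\<alpha> \<nu> = - (2 * \<delta> \<nu> + l * \<eta> \<nu> + \<bar>\<tau>n \<nu> - \<tau>\<bar>)" for \<nu>
  have l_nonneg: "0 \<le> l" using thr l by (simp add: penalty_threshold_def)
  have \<alpha>_nonpos: "\<alpha> \<nu> \<le> 0" for \<nu>
    using \<delta>_nonneg[of \<nu>] mult_nonneg_nonneg[OF l_nonneg \<eta>_nonneg[of \<nu>]] by (simp add: \<alpha>_def)
  have dist_star: "dD (Hn \<nu> xstar ystar) \<le> \<eta> \<nu>" for \<nu>
    using Hn[OF star(1,2), of \<nu>] nrm_dist_eq_zero_iff[OF nrm D, of "H xstar ystar"] star(3)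
    by simp
  \<comment> \<open>Dividing the slack by \<open>1 + \<sigma> \<nu>\<close> keeps its cost below
    \<open>inverse (Suc \<nu>)\<close> however fast \<open>\<sigma>\<close> grows.\<close>
  have "\<exists>u. Hn \<nu> xstar ystar + u \<in> D \<and> nrm u \<le> \<eta> \<nu> + inverse (Suc \<nu>) / (1 + \<sigma> \<nu>)" for \<nu>
  proof -
    have "0 < inverse (Suc \<nu>) / (1 + \<sigma> \<nu>)" using \<sigma>_nonneg[of \<nu>] by simp
    then obtain b where b: "b \<in> D"
      "nrm (Hn \<nu> xstar ystar - b) < dD (Hn \<nu> xstar ystar) + inverse (Suc \<nu>) / (1 + \<sigma> \<nu>)"
      by (rule nrm_dist_approx[OF D(1)])
    then show ?thesis
      using dist_star[of \<nu>] is_norm_minus_commute[OF nrm, of b]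
      by (intro exI[of _ "b - Hn \<nu> xstar ystar"]) auto
  qed
  then obtain u where u: "\<And>\<nu>. Hn \<nu> xstar ystar + u \<nu> \<in> D"
    "\<And>\<nu>. nrm (u \<nu>) \<le> \<eta> \<nu> + inverse (Suc \<nu>) / (1 + \<sigma> \<nu>)" by metis
  have pointwise: "gn \<nu> xstar ystar + \<alpha> \<nu> \<le> gn \<nu> xstar z + l * dD (Hn \<nu> xstar z) + \<tau>n \<nu>"
    if "z \<in> Yn \<nu>" for \<nu> z
  proof -
    have z: "z \<in> Y" using that Yn(2) by blast
    have "l * dD (H xstar z) \<le> l * (dD (Hn \<nu> xstar z) + \<eta> \<nu>)"
      using Hn[OF star(1) z, of \<nu>] by (intro mult_left_mono l_nonneg) linarith
    then show ?thesis
      using penalty_threshold_exact[OF nrm D(1) thr l star(6) z] gn[OF star(1,2), of \<nu>]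
        gn[OF star(1) z, of \<nu>] by (simp add: \<alpha>_def algebra_simps)
  qed
  \<comment> \<open>The fixed \<open>l\<close> is an admissible multiplier only from some index on.
    From there \<open>\<theta> \<nu> * lbar \<nu> * \<eta> \<nu>\<close> also dominates
    \<open>\<theta> \<nu> * l * \<eta> \<nu>\<close>.\<close>
  have l_lbar: "\<forall>\<^sub>F \<nu> in sequentially. l \<le> lbar \<nu>"
    using lbar by (simp add: filterlim_at_top)
  have feas: "\<forall>\<^sub>F \<nu> in sequentially. (xstar, ystar, u \<nu>, \<alpha> \<nu>, l) \<in> feas \<nu>"
    using l_lbar
    by eventually_elim (simp add: Pn_feasible_def u(1) pointwise star(1,2) l_nonneg \<alpha>_nonpos)
  have cost: "\<sigma> \<nu> * nrm (u \<nu>) \<le> \<sigma> \<nu> * \<eta> \<nu> + inverse (Suc \<nu>)" for \<nu>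
  proof -
    have "\<sigma> \<nu> * nrm (u \<nu>) \<le> \<sigma> \<nu> * (\<eta> \<nu> + inverse (Suc \<nu>) / (1 + \<sigma> \<nu>))"
      by (intro mult_left_mono u \<sigma>_nonneg)
    also have "\<dots> = \<sigma> \<nu> * \<eta> \<nu> + \<sigma> \<nu> / (1 + \<sigma> \<nu>) * inverse (Suc \<nu>)"
      by (simp add: algebra_simps)
    also have "\<dots> \<le> \<sigma> \<nu> * \<eta> \<nu> + 1 * inverse (Suc \<nu>)"
      using \<sigma>_nonneg[of \<nu>] by (intro add_left_mono mult_right_mono) auto
    finally show ?thesis by simp
  qed
  have pen: "(\<lambda>\<nu>. \<sigma> \<nu> * nrm (u \<nu>) - \<theta> \<nu> * \<alpha> \<nu>) \<longlonglongrightarrow> 0"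
  proof (rule Lim_null_comparison)
    show "\<forall>\<^sub>F \<nu> in sequentially. norm (\<sigma> \<nu> * nrm (u \<nu>) - \<theta> \<nu> * \<alpha> \<nu>) \<le>
      \<sigma> \<nu> * \<eta> \<nu> + inverse (Suc \<nu>) + 2 * (\<theta> \<nu> * \<delta> \<nu>) + \<theta> \<nu> * lbar \<nu> * \<eta> \<nu> + \<theta> \<nu> * \<bar>\<tau>n \<nu> - \<tau>\<bar>"
      using l_lbar
    proof eventually_elim
      case (elim \<nu>)
      have "\<theta> \<nu> * l * \<eta> \<nu> \<le> \<theta> \<nu> * lbar \<nu> * \<eta> \<nu>"
        by (intro mult_right_mono mult_left_mono elim \<theta>_nonneg \<eta>_nonneg)
      moreover have "0 \<le> \<sigma> \<nu> * nrm (u \<nu>) - \<theta> \<nu> * \<alpha> \<nu>"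
        using mult_nonneg_nonneg[OF \<sigma>_nonneg[of \<nu>] nrm_nonneg[of "u \<nu>"]]
          mult_nonneg_nonpos[OF \<theta>_nonneg \<alpha>_nonpos, of \<nu> \<nu>] by linarith
      ultimately show ?case using cost[of \<nu>] by (simp add: \<alpha>_def algebra_simps)
    qed
    show "(\<lambda>\<nu>. \<sigma> \<nu> * \<eta> \<nu> + inverse (Suc \<nu>) + 2 * (\<theta> \<nu> * \<delta> \<nu>) + \<theta> \<nu> * lbar \<nu> * \<eta> \<nu>
        + \<theta> \<nu> * \<bar>\<tau>n \<nu> - \<tau>\<bar>) \<longlonglongrightarrow> 0"
      using tendsto_add[OF tendsto_add[OF tendsto_add[OF tendsto_add[OF \<sigma>\<eta>
          LIMSEQ_inverse_real_of_nat] tendsto_mult_left[OF \<theta>\<delta>, of 2]] \<theta>\<eta>] \<theta>\<tau>] by simp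
  qed
  have u0: "u \<longlonglongrightarrow> 0"
  proof (rule is_norm_tendsto_zeroD[OF nrm])
    have lim: "(\<lambda>\<nu>. \<eta> \<nu> + inverse (Suc \<nu>)) \<longlonglongrightarrow> 0"
      using tendsto_add[OF \<eta> LIMSEQ_inverse_real_of_nat] by simp
    have "inverse (Suc \<nu>) / (1 + \<sigma> \<nu>) \<le> inverse (Suc \<nu>) / 1" for \<nu>
      using \<sigma>_nonneg[of \<nu>] by (intro divide_left_mono) auto
    then have "nrm (u \<nu>) \<le> \<eta> \<nu> + inverse (Suc \<nu>)" for \<nu>
      using u(2)[of \<nu>] by (metis add_left_mono div_by_1 order_trans)
    then show "(\<lambda>\<nu>. nrm (u \<nu>)) \<longlonglongrightarrow> 0"
      by (intro tendsto_sandwich[OF _ _ tendsto_const lim]) (auto simp: nrm_nonneg)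
  qed
  \<comment> \<open>Conditional, because the weighted error controls \<open>\<tau>n\<close> only
    where \<open>\<theta>\<close> stays away from zero.\<close>
  have \<alpha>0: "\<alpha> \<longlonglongrightarrow> 0" if "\<tau>n \<longlonglongrightarrow> \<tau>"
  proof -
    have "(\<lambda>\<nu>. - (2 * \<delta> \<nu> + l * \<eta> \<nu> + \<bar>\<tau>n \<nu> - \<tau>\<bar>)) \<longlonglongrightarrow> - (2 * 0 + l * 0 + \<bar>\<tau> - \<tau>\<bar>)"
      by (intro tendsto_intros \<delta> \<eta> that)
    then show ?thesis by (simp add: \<alpha>_def[abs_def])
  qed
  show ?thesis by (rule that[OF feas pen u0]) (rule \<alpha>0)
qed

text \<open>The gap above \<open>m\<close> is split: \<open>b\<close> bounds \<open>fn\<close>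
  eventually and \<open>c - b\<close> is left for the penalty. The real \<open>c\<close> is inserted
  because \<open>C\<close> may be infinite.\<close>

lemma recovery_objective:
  assumes "(\<lambda>\<nu>. \<sigma> \<nu> * nrm (u \<nu>) - \<theta> \<nu> * \<alpha> \<nu>) \<longlonglongrightarrow> 0" "m < C"
  shows "\<forall>\<^sub>F \<nu> in sequentially. obj \<nu> (xstar, ystar, u \<nu>, \<alpha> \<nu>, l) < C"
proof -
  obtain c where c: "m < ereal c" "ereal c < C" using assms(2) ereal_dense2 by blast
  obtain b where b: "m < ereal b" "b < c"
    using ereal_dense2[OF c(1)] by auto
  have "limsup (\<lambda>\<nu>. fn \<nu> xstar ystar) < ereal b"
    using limsup_fn[OF star(1,2)] star(4) b(1) by simp
  then have "\<forall>\<^sub>F \<nu> in sequentially. fn \<nu> xstar ystar < ereal b" by (rule Limsup_lessD)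
  moreover have "\<forall>\<^sub>F \<nu> in sequentially. \<sigma> \<nu> * nrm (u \<nu>) - \<theta> \<nu> * \<alpha> \<nu> < c - b"
    using order_tendstoD(2)[OF assms(1)] b(2) by simp
  ultimately show ?thesis
  proof eventually_elim
    case (elim \<nu>)
    then have "fn \<nu> xstar ystar + ereal (\<sigma> \<nu> * nrm (u \<nu>) - \<theta> \<nu> * \<alpha> \<nu>) < ereal c"
      by (cases "fn \<nu> xstar ystar") auto
    with c(2) show ?case by (simp add: obj_eq)
  qed
qed

text \<open>The bound in (a): for \<open>C > m\<close>, the recovery points built with the threshold
  itself are eventually feasible with objective below \<open>C\<close>.\<close>

lemma limsup_mn: "limsup mn \<le> m"
  unfolding Limsup_le_iff
proof (intro allI impI)
  fix C assume C: "m < C"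
  obtain l0 where l0: "penalty_threshold nrm (value_fun Y D g H) xstar l0"
    using calm by (auto simp: calm_at_def)
  obtain u \<alpha> where u: "\<forall>\<^sub>F \<nu> in sequentially. (xstar, ystar, u \<nu>, \<alpha> \<nu>, l0) \<in> feas \<nu>"
    "(\<lambda>\<nu>. \<sigma> \<nu> * nrm (u \<nu>) - \<theta> \<nu> * \<alpha> \<nu>) \<longlonglongrightarrow> 0"
    by (rule recovery_sequence[OF l0 order_refl])
  show "\<forall>\<^sub>F \<nu> in sequentially. mn \<nu> < C"
    using u(1) recovery_objective[OF u(2) C]
    by eventually_elim (rule le_less_trans[OF mn_le])
qed

section \<open>Cluster points of near-optimal solutions\<close>

text \<open>This is (c). \<open>limsup_mn\<close> bounds the near-optimal values from above and the
  lower-limit condition bounds \<open>fn\<close> from below; comparing the two yields in turn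
  bounded penalties, optimality of the limit, and convergence of \<open>mn\<close>.\<close>

lemma cluster_point_optimal:
  assumes \<sigma>: "filterlim \<sigma> at_top sequentially" and \<theta>: "filterlim \<theta> at_top sequentially"
    and \<epsilon>: "\<epsilon> \<longlonglongrightarrow> 0"
    and opts: "\<And>\<nu>. eps_opt \<nu> (\<epsilon> \<nu>) (x \<nu>, y \<nu>, u \<nu>, \<alpha> \<nu>, l \<nu>)"
    and N: "infinite N"
    and lim: "((\<lambda>\<nu>. (x \<nu>, y \<nu>, u \<nu>, \<alpha> \<nu>, l \<nu>)) \<longlongrightarrow> (xh, yh, uh, \<alpha>h, lh)) (along N)"
  shows "P_optimal X Y D f g H \<tau> xh yh" "(mn \<longlongrightarrow> m) (along N)"
proof -
  let ?F = "along N"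
  have F: "?F \<noteq> bot" by (rule along_neq_bot[OF N])
  have seq: "?F \<le> sequentially" by simp
  have x: "(x \<longlongrightarrow> xh) ?F" and y: "(y \<longlongrightarrow> yh) ?F" and l: "(l \<longlongrightarrow> lh) ?F"
    using tendsto_fst[OF lim] tendsto_fst[OF tendsto_snd[OF lim]]
      tendsto_snd[OF tendsto_snd[OF tendsto_snd[OF tendsto_snd[OF lim]]]] by simp_all
  have feas: "x \<nu> \<in> X" "y \<nu> \<in> Y" "Hn \<nu> (x \<nu>) (y \<nu>) + u \<nu> \<in> D" "\<alpha> \<nu> \<le> 0" "0 \<le> l \<nu>"
    "\<And>z. z \<in> Yn \<nu> \<Longrightarrow>
      gn \<nu> (x \<nu>) (y \<nu>) + \<alpha> \<nu> \<le> gn \<nu> (x \<nu>) z + l \<nu> * dD (Hn \<nu> (x \<nu>) z) + \<tau>n \<nu>" for \<nu>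
    using opts[of \<nu>] by (auto simp: Pn_eps_optimal_def Pn_feasible_def)
  have xh: "xh \<in> X" and yh: "yh \<in> Y"
    using Lim_in_closed_set[OF X _ F x] Lim_in_closed_set[OF Y _ F y] feas by auto
  define pen where "pen \<nu> = \<sigma> \<nu> * nrm (u \<nu>) - \<theta> \<nu> * \<alpha> \<nu>" for \<nu>
  have pen: "0 \<le> \<sigma> \<nu> * nrm (u \<nu>)" "0 \<le> - (\<theta> \<nu> * \<alpha> \<nu>)" for \<nu>
    using mult_nonneg_nonneg[OF \<sigma>_nonneg[of \<nu>] nrm_nonneg[of "u \<nu>"]]
      mult_nonneg_nonpos[OF \<theta>_nonneg feas(4), of \<nu> \<nu>] by linarith+
  \<comment> \<open>The objective value is finite, so \<open>fn\<close> is finite at these points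
    and \<open>real_of_ereal\<close> loses nothing.\<close>
  define fr where "fr \<nu> = real_of_ereal (fn \<nu> (x \<nu>) (y \<nu>))" for \<nu>
  have fr: "fn \<nu> (x \<nu>) (y \<nu>) = ereal (fr \<nu>)" and
    mn_ge: "ereal (fr \<nu> + pen \<nu>) \<le> mn \<nu> + ereal (\<epsilon> \<nu>)" for \<nu>
  proof -
    have o: "\<bar>obj \<nu> (x \<nu>, y \<nu>, u \<nu>, \<alpha> \<nu>, l \<nu>)\<bar> \<noteq> \<infinity>"
      "obj \<nu> (x \<nu>, y \<nu>, u \<nu>, \<alpha> \<nu>, l \<nu>) \<le> mn \<nu> + ereal (\<epsilon> \<nu>)"
      using opts[of \<nu>] by (auto simp: Pn_eps_optimal_def)
    from o(1) show *: "fn \<nu> (x \<nu>) (y \<nu>) = ereal (fr \<nu>)"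
      by (cases "fn \<nu> (x \<nu>) (y \<nu>)") (auto simp: obj_eq fr_def)
    with o(2) show "ereal (fr \<nu> + pen \<nu>) \<le> mn \<nu> + ereal (\<epsilon> \<nu>)" by (simp add: obj_eq pen_def)
  qed
  have fr_lower: "\<forall>\<^sub>F \<nu> in ?F. c < fr \<nu>" if "ereal c < f xh yh" for c
  proof -
    define xs where "xs \<nu> = (if \<nu> \<in> N then x \<nu> else xh)" for \<nu>
    define ys where "ys \<nu> = (if \<nu> \<in> N then y \<nu> else yh)" for \<nu>
    have "f xh yh \<le> liminf (\<lambda>\<nu>. fn \<nu> (xs \<nu>) (ys \<nu>))"
      using liminf_fn[OF xh yh, of xs ys] feas xh yh
        tendsto_along_extend[OF x] tendsto_along_extend[OF y]
      by (simp add: xs_def[abs_def] ys_def[abs_def])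
    with that have "\<forall>\<^sub>F \<nu> in sequentially. ereal c < fn \<nu> (xs \<nu>) (ys \<nu>)"
      by (intro less_LiminfD) (rule less_le_trans)
    then show ?thesis unfolding eventually_inf_principal
      by (rule eventually_mono) (auto simp: xs_def ys_def fr)
  qed
  obtain mr where mr: "m = ereal mr" using star(5) by (cases m) auto
  have \<epsilon>F: "(\<epsilon> \<longlongrightarrow> 0) ?F" by (rule tendsto_mono[OF seq \<epsilon>])
  have mn_upper: "\<forall>\<^sub>F \<nu> in ?F. mn \<nu> < C" if "m < C" for C
    using Limsup_lessD[OF le_less_trans[OF limsup_mn that]] filter_leD[OF seq] by blast
  have upper: "\<forall>\<^sub>F \<nu> in ?F. fr \<nu> + pen \<nu> < c" if "mr < c" for c
  proof -
    \<comment> \<open>Eventually \<open>mn \<nu> < b\<close> and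
      \<open>\<epsilon> \<nu> < c - b\<close>, which add up to \<open>c\<close>.\<close>
    define b where "b = (mr + c) / 2"
    have b: "mr < b" "b < c" using that by (auto simp: b_def)
    have "\<forall>\<^sub>F \<nu> in ?F. \<epsilon> \<nu> < c - b" using order_tendstoD(2)[OF \<epsilon>F] b by simp
    moreover have "\<forall>\<^sub>F \<nu> in ?F. mn \<nu> < ereal b" using mn_upper[of "ereal b"] mr b by simp
    ultimately show ?thesis
    proof eventually_elim
      case (elim \<nu>)
      then show ?case using mn_ge[of \<nu>] by (cases "mn \<nu>") auto
    qed
  qed
  \<comment> \<open>\<open>f xh yh\<close> may still be infinite here, so a real \<open>c0\<close>
    below it is used. Eventually \<open>fr \<nu> > c0\<close> and
    \<open>fr \<nu> + pen \<nu> < mr + 1\<close>, so \<open>K\<close> bounds the penalty and hence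
    each of its two nonnegative terms.\<close>
  obtain c0 where c0: "ereal c0 < f xh yh"
    using f_ran(1)[of xh yh] ereal_dense2[of "-\<infinity>" "f xh yh"] by auto
  define K where "K = mr + 1 - c0"
  have K: "\<forall>\<^sub>F \<nu> in ?F. \<sigma> \<nu> * nrm (u \<nu>) < K \<and> - (\<theta> \<nu> * \<alpha> \<nu>) < K"
    using fr_lower[OF c0] upper[of "mr + 1", simplified]
  proof eventually_elim
    case (elim \<nu>)
    then show ?case using pen[of \<nu>] unfolding K_def pen_def by linarith
  qed
  have vanish: "((\<lambda>\<nu>. K / h \<nu>) \<longlongrightarrow> 0) ?F" if "filterlim h at_top sequentially" for h
    using real_tendsto_divide_at_top[OF tendsto_const that] seq tendsto_mono by blast
  have pos: "\<forall>\<^sub>F \<nu> in ?F. 0 < h \<nu>" if "filterlim h at_top sequentially" for h :: "nat \<Rightarrow> real"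
    using that filter_leD[OF seq] by (auto simp: filterlim_at_top_dense)
  have nu: "((\<lambda>\<nu>. nrm (u \<nu>)) \<longlongrightarrow> 0) ?F"
  proof (rule tendsto_sandwich[OF _ _ tendsto_const vanish[OF \<sigma>]])
    show "\<forall>\<^sub>F \<nu> in ?F. nrm (u \<nu>) \<le> K / \<sigma> \<nu>"
      using K pos[OF \<sigma>] by eventually_elim (simp add: field_simps)
  qed (simp add: nrm_nonneg)
  have \<alpha>: "(\<alpha> \<longlongrightarrow> 0) ?F"
  proof (rule Lim_null_comparison[OF _ vanish[OF \<theta>]])
    show "\<forall>\<^sub>F \<nu> in ?F. norm (\<alpha> \<nu>) \<le> K / \<theta> \<nu>"
      using K pos[OF \<theta>] by eventually_elim (use feas(4) in \<open>simp add: field_simps\<close>)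
  qed
  \<comment> \<open>Uniform errors allow the argument \<open>z \<nu>\<close> to vary with the index;
    this serves both for \<open>y\<close> and for the points recovered from
    \<open>Yn\<close>.\<close>
  have gn_lim: "((\<lambda>\<nu>. gn \<nu> (x \<nu>) (z \<nu>)) \<longlongrightarrow> g xh zh) ?F"
    and dist_lim: "((\<lambda>\<nu>. dD (Hn \<nu> (x \<nu>) (z \<nu>))) \<longlongrightarrow> dD (H xh zh)) ?F"
    if z: "\<And>\<nu>. z \<nu> \<in> Y" "zh \<in> Y" "(z \<longlongrightarrow> zh) ?F" for z zh
  proof -
    have xz: "((\<lambda>\<nu>. (x \<nu>, z \<nu>)) \<longlongrightarrow> (xh, zh)) ?F" by (intro tendsto_Pair x z)
    have "((\<lambda>\<nu>. g (x \<nu>) (z \<nu>)) \<longlongrightarrow> g xh zh) ?F"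
      using continuous_on_tendsto_compose[OF g xz] xh feas z by simp
    moreover have "((\<lambda>\<nu>. gn \<nu> (x \<nu>) (z \<nu>) - g (x \<nu>) (z \<nu>)) \<longlongrightarrow> 0) ?F"
      by (rule Lim_null_comparison[OF _ tendsto_mono[OF seq \<delta>]]) (simp add: gn feas z)
    ultimately show "((\<lambda>\<nu>. gn \<nu> (x \<nu>) (z \<nu>)) \<longlongrightarrow> g xh zh) ?F"
      using tendsto_add by fastforce
    have "((\<lambda>\<nu>. H (x \<nu>) (z \<nu>)) \<longlongrightarrow> H xh zh) ?F"
      using continuous_on_tendsto_compose[OF H xz] xh feas z by simp
    then have "((\<lambda>\<nu>. dD (H (x \<nu>) (z \<nu>))) \<longlongrightarrow> dD (H xh zh)) ?F"
      by (rule tendsto_nrm_dist[OF nrm D(1)])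
    moreover have "((\<lambda>\<nu>. dD (Hn \<nu> (x \<nu>) (z \<nu>)) - dD (H (x \<nu>) (z \<nu>))) \<longlongrightarrow> 0) ?F"
      by (rule Lim_null_comparison[OF _ tendsto_mono[OF seq \<eta>]]) (simp add: Hn feas z)
    ultimately show "((\<lambda>\<nu>. dD (Hn \<nu> (x \<nu>) (z \<nu>))) \<longlongrightarrow> dD (H xh zh)) ?F"
      using tendsto_add by fastforce
  qed
  \<comment> \<open>The upper-level constraint exhibits a point of \<open>D\<close> that differs
    from \<open>Hn \<nu> (x \<nu>) (y \<nu>)\<close> by \<open>u \<nu>\<close>.\<close>
  have "dD (Hn \<nu> (x \<nu>) (y \<nu>)) \<le> nrm (u \<nu>)" for \<nu>
    using nrm_dist_le[OF nrm feas(3), of "Hn \<nu> (x \<nu>) (y \<nu>)" \<nu>] is_norm_minus[OF nrm, of "u \<nu>"]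
    by simp
  then have "dD (H xh yh) \<le> 0"
    by (intro tendsto_le[OF F nu dist_lim[OF feas(2) yh y]]) simp
  then have HD: "H xh yh \<in> D"
    using nrm_dist_nonneg[OF nrm D(1)] nrm_dist_eq_zero_iff[OF nrm D] by (metis order_antisym)
  have "\<forall>\<^sub>F \<nu> in sequentially. 1 \<le> \<theta> \<nu>" using \<theta> by (simp add: filterlim_at_top)
  then have \<tau>n: "(\<tau>n \<longlongrightarrow> \<tau>) ?F"
    by (intro tendsto_mono[OF seq] \<tau>n_tendsto[of 1]) auto
  have lower_level: "g xh yh \<le> g xh z + \<tau>" if z: "z \<in> Y" "H xh z \<in> D" for z
  proof -
    obtain zs where zs: "\<And>\<nu>. zs \<nu> \<in> Yn \<nu>" "zs \<longlonglongrightarrow> z"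
      using PK_converges_recovery[OF Yn(3,1) z(1)] by blast
    have zsY: "zs \<nu> \<in> Y" for \<nu> using zs(1) Yn(2) by blast
    have zsF: "(zs \<longlongrightarrow> z) ?F" by (rule tendsto_mono[OF seq zs(2)])
    \<comment> \<open>The multipliers converge to the finite \<open>lh\<close>, so the penalty tends
      to \<open>lh * dD (H xh z)\<close>, which is zero because
      \<open>H xh z \<in> D\<close>.\<close>
    have "((\<lambda>\<nu>. gn \<nu> (x \<nu>) (zs \<nu>) + l \<nu> * dD (Hn \<nu> (x \<nu>) (zs \<nu>)) + \<tau>n \<nu>)
        \<longlongrightarrow> g xh z + lh * dD (H xh z) + \<tau>) ?F"
      by (intro tendsto_intros gn_lim dist_lim zsY zsF z l \<tau>n)
    moreover have "((\<lambda>\<nu>. gn \<nu> (x \<nu>) (y \<nu>) + \<alpha> \<nu>) \<longlongrightarrow> g xh yh + 0) ?F"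
      by (intro tendsto_add gn_lim feas yh y \<alpha>)
    ultimately have "g xh yh + 0 \<le> g xh z + lh * dD (H xh z) + \<tau>"
      by (rule tendsto_le[OF F]) (simp add: feas zs)
    moreover have "dD (H xh z) = 0" using nrm_dist_eq_zero_iff[OF nrm D] z(2) by blast
    ultimately show ?thesis by simp
  qed
  have "ereal (g xh yh) - ereal \<tau> \<le> (INF z\<in>{z \<in> Y. H xh z \<in> D}. ereal (g xh z))"
    using lower_level by (intro INF_greatest) (simp add: algebra_simps)
  then have "ereal (g xh yh) \<le> (INF z\<in>{z \<in> Y. H xh z \<in> D}. ereal (g xh z)) + ereal \<tau>"
    by (subst (asm) ereal_minus_le) simp_all
  then have Pfeas: "(xh, yh) \<in> P_feasible X Y D g H \<tau>"
    using xh yh HD by (simp add: P_feasible_def tau_argmin_def)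
  \<comment> \<open>Otherwise a real \<open>c\<close> strictly between would satisfy
    \<open>c < fr \<nu>\<close> and \<open>fr \<nu> + pen \<nu> < c\<close> eventually along
    \<open>N\<close>, although the penalty is nonnegative.\<close>
  have "f xh yh \<le> m"
  proof (rule ccontr)
    assume "\<not> f xh yh \<le> m"
    then obtain c where c: "m < ereal c" "ereal c < f xh yh"
      using ereal_dense2 not_le by metis
    have "mr < c" using c(1) mr by simp
    from fr_lower[OF c(2)] upper[OF this] have "\<forall>\<^sub>F \<nu> in ?F. False"
    proof eventually_elim
      case (elim \<nu>)
      then show ?case using pen[of \<nu>] unfolding pen_def by linarith
    qed
    then show False using F by (simp add: trivial_limit_def)
  qed
  moreover have "m \<le> f xh yh" unfolding P_min_def by (rule INF_lower2[OF Pfeas]) simp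
  ultimately have fm: "f xh yh = m" by simp
  with Pfeas mr show "P_optimal X Y D f g H \<tau> xh yh" by (simp add: P_optimal_def)
  show "(mn \<longlongrightarrow> m) ?F"
  proof (rule order_tendstoI)
    fix a assume "a < m"
    \<comment> \<open>A real \<open>b\<close> is inserted since \<open>a\<close> may be
      \<open>-\<infinity>\<close>; near-optimality with \<open>fr \<nu> > c\<close> and
      \<open>\<epsilon> \<nu> < c - b\<close> gives \<open>mn \<nu> > b\<close>.\<close>
    then obtain b where b: "a < ereal b" "b < mr" using ereal_dense2[of a m] mr by auto
    define c where "c = (b + mr) / 2"
    have c: "b < c" "c < mr" using b by (auto simp: c_def)
    have "\<forall>\<^sub>F \<nu> in ?F. c < fr \<nu>" using fr_lower[of c] c fm mr by simp
    moreover have "\<forall>\<^sub>F \<nu> in ?F. \<epsilon> \<nu> < c - b" using order_tendstoD(2)[OF \<epsilon>F] c by simp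
    ultimately show "\<forall>\<^sub>F \<nu> in ?F. a < mn \<nu>"
    proof eventually_elim
      case (elim \<nu>)
      have "ereal b < mn \<nu>"
        using mn_ge[of \<nu>] elim pen[of \<nu>] by (cases "mn \<nu>") (auto simp: pen_def)
      with b(1) show ?case by simp
    qed
  qed (rule mn_upper)
qed

section \<open>Convergence of the minimum values and near-optimal recovery\<close>

text \<open>The upper half is \<open>limsup_mn\<close>. If the lower half failed at infinitely many
  indices, the optimal solutions in \<open>B\<close> at those indices would cluster, and
  \<open>cluster_point_optimal\<close> would force convergence to \<open>m\<close> along some of
  them.\<close>

lemma mn_tendsto:
  assumes \<sigma>: "filterlim \<sigma> at_top sequentially" and \<theta>: "filterlim \<theta> at_top sequentially"
    and B: "compact B" "\<And>\<nu>. \<exists>w\<in>B. eps_opt \<nu> 0 w"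
  shows "mn \<longlonglongrightarrow> m"
proof (rule order_tendstoI)
  fix C assume "m < C"
  then show "\<forall>\<^sub>F \<nu> in sequentially. mn \<nu> < C"
    by (intro Limsup_lessD le_less_trans[OF limsup_mn])
next
  fix a assume a: "a < m"
  obtain w where w: "\<And>\<nu>. w \<nu> \<in> B" "\<And>\<nu>. eps_opt \<nu> 0 (w \<nu>)" using B(2) by metis
  show "\<forall>\<^sub>F \<nu> in sequentially. a < mn \<nu>"
  proof (rule ccontr)
    define M where "M = {\<nu>. \<not> a < mn \<nu>}"
    assume "\<not> (\<forall>\<^sub>F \<nu> in sequentially. a < mn \<nu>)"
    then have M: "infinite M"
      by (simp add: M_def cofinite_eq_sequentially[symmetric] eventually_cofinite)
    \<comment> \<open>Compactness is applied to \<open>w\<close> enumerated over \<open>M\<close>,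
      so that the extracted indices \<open>s\<close> stay among the bad ones.\<close>
    have "\<forall>n. (w \<circ> enumerate M) n \<in> B" using w(1) by simp
    then obtain r L where r: "strict_mono r" "(w \<circ> enumerate M \<circ> r) \<longlonglongrightarrow> L"
      using B(1) unfolding compact_def by metis
    define s where "s = enumerate M \<circ> r"
    have s: "strict_mono s"
      unfolding s_def using strict_mono_enumerate[OF M] r(1) by (rule strict_mono_o)
    have sM: "range s \<subseteq> M" using enumerate_in_set[OF M] by (auto simp: s_def)
    have inf: "infinite (range s)"
      using s by (simp add: range_inj_infinite strict_mono_imp_inj_on)
    obtain xh yh uh \<alpha>h lh where L: "L = (xh, yh, uh, \<alpha>h, lh)" by (cases L) auto
    have lim: "(w \<longlongrightarrow> L) (along (range s))"
      by (rule tendsto_along_range[OF s]) (use r(2) in \<open>simp add: s_def comp_assoc\<close>)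
    have "(mn \<longlongrightarrow> m) (along (range s))"
      by (rule cluster_point_optimal(2)[OF \<sigma> \<theta> tendsto_const _ inf, of
            "\<lambda>\<nu>. fst (w \<nu>)" "\<lambda>\<nu>. fst (snd (w \<nu>))" "\<lambda>\<nu>. fst (snd (snd (w \<nu>)))"
            "\<lambda>\<nu>. fst (snd (snd (snd (w \<nu>))))" "\<lambda>\<nu>. snd (snd (snd (snd (w \<nu>))))"
            xh yh uh \<alpha>h lh])
         (use w(2) lim L in simp_all)
    then have "\<forall>\<^sub>F \<nu> in along (range s). a < mn \<nu>" using a by (rule order_tendstoD)
    moreover have "\<forall>\<^sub>F \<nu> in along (range s). \<not> a < mn \<nu>"
      unfolding eventually_inf_principal using sM by (intro always_eventually) (auto simp: M_def)
    ultimately have "\<forall>\<^sub>F \<nu> in along (range s). False" by eventually_elim simp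
    then show False using along_neq_bot[OF inf] by (simp add: trivial_limit_def)
  qed
qed

text \<open>The recovery points have objective values with upper limit at most \<open>m\<close>, and
  \<open>mn\<close> tends to \<open>m\<close>; their optimality gap therefore vanishes and serves as
  \<open>\<epsilon>\<close>.\<close>

lemma eps_optimal_recovery:
  assumes \<sigma>: "filterlim \<sigma> at_top sequentially" and \<theta>: "filterlim \<theta> at_top sequentially"
    and B: "compact B" "\<And>\<nu>. \<exists>w\<in>B. eps_opt \<nu> 0 w"
    and thr: "penalty_threshold nrm (value_fun Y D g H) xstar l0" and l: "l0 \<le> l"
  shows "\<exists>\<epsilon> w. (\<forall>\<nu>. 0 \<le> \<epsilon> \<nu>) \<and> \<epsilon> \<longlonglongrightarrow> 0 \<and> (\<forall>\<nu>. eps_opt \<nu> (\<epsilon> \<nu>) (w \<nu>)) \<and>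
    w \<longlonglongrightarrow> (xstar, ystar, 0, 0, l)"
proof -
  obtain v where v: "\<And>\<nu>. eps_opt \<nu> 0 (v \<nu>)" using B(2) by metis
  obtain u \<alpha> where u: "\<forall>\<^sub>F \<nu> in sequentially. (xstar, ystar, u \<nu>, \<alpha> \<nu>, l) \<in> feas \<nu>"
    "(\<lambda>\<nu>. \<sigma> \<nu> * nrm (u \<nu>) - \<theta> \<nu> * \<alpha> \<nu>) \<longlonglongrightarrow> 0"
    "u \<longlonglongrightarrow> 0" "\<tau>n \<longlonglongrightarrow> \<tau> \<Longrightarrow> \<alpha> \<longlonglongrightarrow> 0"
    by (rule recovery_sequence[OF thr l]) (rule that; simp)
  have "\<forall>\<^sub>F \<nu> in sequentially. 1 \<le> \<theta> \<nu>" using \<theta> by (simp add: filterlim_at_top)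
  then have \<alpha>: "\<alpha> \<longlonglongrightarrow> 0" by (intro u(4) \<tau>n_tendsto[of 1]) auto
  define p where "p \<nu> = (xstar, ystar, u \<nu>, \<alpha> \<nu>, l)" for \<nu>
  have p: "p \<longlonglongrightarrow> (xstar, ystar, 0, 0, l)"
    unfolding p_def[abs_def] by (intro tendsto_intros u(3) \<alpha>)
  obtain mr where mr: "m = ereal mr" using star(5) by (cases m) auto
  \<comment> \<open>An optimal solution has a finite objective value, and that value is the
    minimum.\<close>
  have mn_real: "\<exists>r. mn \<nu> = ereal r" for \<nu>
  proof -
    have "v \<nu> \<in> feas \<nu>" "\<bar>obj \<nu> (v \<nu>)\<bar> \<noteq> \<infinity>" "obj \<nu> (v \<nu>) \<le> mn \<nu>"
      using v[of \<nu>] by (auto simp: Pn_eps_optimal_def zero_ereal_def[symmetric])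
    then show ?thesis using mn_le[of "v \<nu>" \<nu>] by (cases "mn \<nu>") auto
  qed
  then obtain r where r: "\<And>\<nu>. mn \<nu> = ereal (r \<nu>)" by metis
  have r_lim: "r \<longlonglongrightarrow> mr" using mn_tendsto[OF \<sigma> \<theta> B] by (simp add: r mr)
  \<comment> \<open>Recovery points are feasible with finite value only from some index on, whereas
    every index needs a near-optimal point; optimal solutions \<open>v \<nu>\<close> with tolerance
    zero fill the rest.\<close>
  define good where "good \<nu> \<longleftrightarrow> p \<nu> \<in> feas \<nu> \<and> obj \<nu> (p \<nu>) < \<infinity>" for \<nu>
  define w where "w \<nu> = (if good \<nu> then p \<nu> else v \<nu>)" for \<nu>
  define \<epsilon> where "\<epsilon> \<nu> = (if good \<nu> then real_of_ereal (obj \<nu> (p \<nu>)) - r \<nu> else 0)" for \<nu>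
  have m_less: "m < \<infinity>" by (simp add: mr)
  have good: "\<forall>\<^sub>F \<nu> in sequentially. good \<nu>"
    using u(1) recovery_objective[OF u(2) m_less, of l]
    by eventually_elim (simp add: good_def p_def)
  have objp: "obj \<nu> (p \<nu>) = ereal (r \<nu> + \<epsilon> \<nu>)" "0 \<le> \<epsilon> \<nu>" if "good \<nu>" for \<nu>
  proof -
    have ge: "ereal (r \<nu>) \<le> obj \<nu> (p \<nu>)" using mn_le[of "p \<nu>" \<nu>] that r by (simp add: good_def)
    then show *: "obj \<nu> (p \<nu>) = ereal (r \<nu> + \<epsilon> \<nu>)"
      using that by (cases "obj \<nu> (p \<nu>)") (auto simp: \<epsilon>_def good_def)
    show "0 \<le> \<epsilon> \<nu>" using ge by (simp add: *)
  qed
  have nonneg: "0 \<le> \<epsilon> \<nu>" for \<nu> using objp(2)[of \<nu>] by (cases "good \<nu>") (auto simp: \<epsilon>_def)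
  have "\<epsilon> \<longlonglongrightarrow> 0"
  proof (rule order_tendstoI)
    fix a :: real assume "a < 0"
    then show "\<forall>\<^sub>F \<nu> in sequentially. a < \<epsilon> \<nu>" 
      using nonneg by (intro always_eventually) (auto intro: less_le_trans)
  next
    fix a :: real assume a: "0 < a"
    \<comment> \<open>Half of \<open>a\<close> bounds the excess of the objective over
      \<open>mr\<close>, the other half the shortfall of \<open>r \<nu>\<close>.\<close>
    have "\<forall>\<^sub>F \<nu> in sequentially. obj \<nu> (p \<nu>) < ereal (mr + a / 2)"
      unfolding p_def by (rule recovery_objective[OF u(2)]) (simp add: mr a)
    moreover have "\<forall>\<^sub>F \<nu> in sequentially. mr - a / 2 < r \<nu>"
      using order_tendstoD(1)[OF r_lim] a by simp
    ultimately show "\<forall>\<^sub>F \<nu> in sequentially. \<epsilon> \<nu> < a" using good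
      by eventually_elim (auto simp: objp(1))
  qed
  moreover have "eps_opt \<nu> (\<epsilon> \<nu>) (w \<nu>)" for \<nu>
  proof (cases "good \<nu>")
    case True
    then have "p \<nu> \<in> feas \<nu>" by (simp add: good_def)
    with True objp[OF True] show ?thesis by (simp add: w_def Pn_eps_optimal_def r)
  next
    case False
    then show ?thesis using v by (simp add: w_def \<epsilon>_def)
  qed
  moreover have "w \<longlonglongrightarrow> (xstar, ystar, 0, 0, l)"
    by (rule Lim_transform_eventually[OF p]) (use good in \<open>auto simp: w_def elim!: eventually_mono\<close>)
  ultimately show ?thesis using nonneg by blast
qed

end

section \<open>Assembly of (a), (b) and (c)\<close>

theorem theorem2p6:
  fixes nrm :: "real ^ 'q \<Rightarrow> real"
    and X :: "(real ^ 'n) set" and Y :: "(real ^ 'm) set" and D :: "(real ^ 'q) set"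
    and Yn :: "nat \<Rightarrow> (real ^ 'm) set"
    and f :: "real ^ 'n \<Rightarrow> real ^ 'm \<Rightarrow> ereal" and fn :: "nat \<Rightarrow> real ^ 'n \<Rightarrow> real ^ 'm \<Rightarrow> ereal"
    and g :: "real ^ 'n \<Rightarrow> real ^ 'm \<Rightarrow> real" and gn :: "nat \<Rightarrow> real ^ 'n \<Rightarrow> real ^ 'm \<Rightarrow> real"
    and H :: "real ^ 'n \<Rightarrow> real ^ 'm \<Rightarrow> real ^ 'q"
    and Hn :: "nat \<Rightarrow> real ^ 'n \<Rightarrow> real ^ 'm \<Rightarrow> real ^ 'q"
    and \<sigma> \<theta> lbar \<tau>n \<delta> \<eta> :: "nat \<Rightarrow> real" and \<tau> :: real
    and xstar :: "real ^ 'n" and ystar :: "real ^ 'm"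
  assumes norm: "is_norm nrm"
    and param: "0 \<le> \<tau>" "\<And>\<nu>. 0 \<le> \<tau>n \<nu>"
    and A1: "X \<noteq> {}" "closed X" "Y \<noteq> {}" "closed Y" "D \<noteq> {}" "closed D"
    and A2: "\<And>\<nu>. Yn \<nu> \<noteq> {}" "\<And>\<nu>. Yn \<nu> \<subseteq> Y" "PK_converges Yn Y"
    and A3: "\<delta> \<longlonglongrightarrow> 0"
      "\<And>\<nu>. (SUP (x, y)\<in>X \<times> Y. ereal \<bar>gn \<nu> x y - g x y\<bar>) \<le> ereal (\<delta> \<nu>)"
      "continuous_on (X \<times> Y) (\<lambda>(x, y). g x y)"
    and A4: "\<eta> \<longlonglongrightarrow> 0"
      "\<And>\<nu>. (SUP (x, y)\<in>X \<times> Y. ereal \<bar>nrm_dist nrm (Hn \<nu> x y) D - nrm_dist nrm (H x y) D\<bar>)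
            \<le> ereal (\<eta> \<nu>)"
      "continuous_on (X \<times> Y) (\<lambda>(x, y). H x y)"
    and f_ran: "\<And>x y. f x y \<noteq> -\<infinity>" "\<And>\<nu> x y. fn \<nu> x y \<noteq> -\<infinity>"
    and A5: "\<And>x y. x \<in> X \<Longrightarrow> y \<in> Y \<Longrightarrow> limsup (\<lambda>\<nu>. fn \<nu> x y) \<le> f x y"
      "\<And>x y xs ys. x \<in> X \<Longrightarrow> y \<in> Y \<Longrightarrow> (\<And>\<nu>. xs \<nu> \<in> X) \<Longrightarrow> xs \<longlonglongrightarrow> x \<Longrightarrow>
         (\<And>\<nu>. ys \<nu> \<in> Y) \<Longrightarrow> ys \<longlonglongrightarrow> y \<Longrightarrow> liminf (\<lambda>\<nu>. fn \<nu> (xs \<nu>) (ys \<nu>)) \<ge> f x y"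
    and A6: "\<And>\<nu>. 0 \<le> \<sigma> \<nu>" "\<And>\<nu>. 0 \<le> \<theta> \<nu>" "\<And>\<nu>. 0 \<le> lbar \<nu>"
      "filterlim lbar at_top sequentially"
      "(\<lambda>\<nu>. \<sigma> \<nu> * \<eta> \<nu>) \<longlonglongrightarrow> 0"
      "(\<lambda>\<nu>. \<theta> \<nu> * lbar \<nu> * \<eta> \<nu>) \<longlonglongrightarrow> 0"
      "(\<lambda>\<nu>. \<theta> \<nu> * \<delta> \<nu>) \<longlonglongrightarrow> 0"
    and tau_lim: "(\<lambda>\<nu>. \<theta> \<nu> * \<bar>\<tau>n \<nu> - \<tau>\<bar>) \<longlonglongrightarrow> 0"
    and opt: "P_optimal X Y D f g H \<tau> xstar ystar"
    and calm: "calm_at nrm (value_fun Y D g H) xstar"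
  shows
    "((\<exists>c>0. \<forall>\<nu>. c \<le> \<theta> \<nu>) \<longrightarrow>
      limsup (\<lambda>\<nu>. Pn_min nrm X Y (Yn \<nu>) D (fn \<nu>) (gn \<nu>) (Hn \<nu>) (\<sigma> \<nu>) (\<theta> \<nu>) (lbar \<nu>) (\<tau>n \<nu>))
        \<le> P_min X Y D f g H \<tau> \<and>
      \<bar>P_min X Y D f g H \<tau>\<bar> \<noteq> \<infinity>) \<and>
     (filterlim \<sigma> at_top sequentially \<and> filterlim \<theta> at_top sequentially \<and>
      (\<exists>B. compact B \<and>
        (\<forall>\<nu>. \<exists>w\<in>B. Pn_optimal nrm X Y (Yn \<nu>) D (fn \<nu>) (gn \<nu>) (Hn \<nu>)
                      (\<sigma> \<nu>) (\<theta> \<nu>) (lbar \<nu>) (\<tau>n \<nu>) w)) \<longrightarrow>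
      (\<forall>lstar l. penalty_threshold nrm (value_fun Y D g H) xstar lstar \<and> lstar \<le> l \<longrightarrow>
        (\<exists>\<epsilon> w. (\<forall>\<nu>. 0 \<le> \<epsilon> \<nu>) \<and> \<epsilon> \<longlonglongrightarrow> 0 \<and>
          (\<forall>\<nu>. Pn_eps_optimal nrm X Y (Yn \<nu>) D (fn \<nu>) (gn \<nu>) (Hn \<nu>)
                  (\<sigma> \<nu>) (\<theta> \<nu>) (lbar \<nu>) (\<tau>n \<nu>) (\<epsilon> \<nu>) (w \<nu>)) \<and>
          w \<longlonglongrightarrow> (xstar, ystar, 0, 0, l))) \<and>
      (\<lambda>\<nu>. Pn_min nrm X Y (Yn \<nu>) D (fn \<nu>) (gn \<nu>) (Hn \<nu>) (\<sigma> \<nu>) (\<theta> \<nu>) (lbar \<nu>) (\<tau>n \<nu>))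
        \<longlonglongrightarrow> P_min X Y D f g H \<tau> \<and>
      \<bar>P_min X Y D f g H \<tau>\<bar> \<noteq> \<infinity>) \<and>
     (\<forall>\<epsilon> x y u \<alpha> l N xhat yhat uhat \<alpha>hat lhat.
      filterlim \<sigma> at_top sequentially \<and> filterlim \<theta> at_top sequentially \<and>
      (\<forall>\<nu>. 0 \<le> \<epsilon> \<nu>) \<and> \<epsilon> \<longlonglongrightarrow> 0 \<and>
      (\<forall>\<nu>. Pn_eps_optimal nrm X Y (Yn \<nu>) D (fn \<nu>) (gn \<nu>) (Hn \<nu>)
              (\<sigma> \<nu>) (\<theta> \<nu>) (lbar \<nu>) (\<tau>n \<nu>) (\<epsilon> \<nu>) (x \<nu>, y \<nu>, u \<nu>, \<alpha> \<nu>, l \<nu>)) \<and>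
      infinite N \<and>
      ((\<lambda>\<nu>. (x \<nu>, y \<nu>, u \<nu>, \<alpha> \<nu>, l \<nu>)) \<longlongrightarrow> (xhat, yhat, uhat, \<alpha>hat, lhat)) (along N) \<longrightarrow>
      P_optimal X Y D f g H \<tau> xhat yhat \<and>
      ((\<lambda>\<nu>. Pn_min nrm X Y (Yn \<nu>) D (fn \<nu>) (gn \<nu>) (Hn \<nu>) (\<sigma> \<nu>) (\<theta> \<nu>) (lbar \<nu>) (\<tau>n \<nu>))
        \<longlongrightarrow> P_min X Y D f g H \<tau>) (along N) \<and>
      \<bar>P_min X Y D f g H \<tau>\<bar> \<noteq> \<infinity>)"
proof -
  interpret bilevel_approximation nrm X Y D Yn f fn g gn H Hn \<sigma> \<theta> lbar \<tau>n \<delta> \<eta> \<tau> xstar ystar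
  proof
    \<comment> \<open>A bound on the extended-real supremum bounds each member, here the one at the
      pair \<open>(x, y)\<close>.\<close>
    show "\<bar>gn \<nu> x y - g x y\<bar> \<le> \<delta> \<nu>" if "x \<in> X" "y \<in> Y" for \<nu> x y
      using A3(2)[of \<nu>] that unfolding SUP_le_iff by (auto dest!: bspec[of _ _ "(x, y)"])
    show "\<bar>nrm_dist nrm (Hn \<nu> x y) D - nrm_dist nrm (H x y) D\<bar> \<le> \<eta> \<nu>"
      if "x \<in> X" "y \<in> Y" for \<nu> x y
      using A4(2)[of \<nu>] that unfolding SUP_le_iff by (auto dest!: bspec[of _ _ "(x, y)"])
  qed (fact norm A1 A2 A3 A4 f_ran A5 A6 tau_lim opt calm)+
  show ?thesis (is "?a \<and> ?b \<and> ?c")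
  proof (intro conjI)
    show ?a using limsup_mn star(5) by blast
    show ?b
    proof (intro impI)
      assume "filterlim \<sigma> at_top sequentially \<and> filterlim \<theta> at_top sequentially \<and>
        (\<exists>B. compact B \<and> (\<forall>\<nu>. \<exists>w\<in>B. eps_opt \<nu> 0 w))"
      then obtain B where B: "filterlim \<sigma> at_top sequentially" "filterlim \<theta> at_top sequentially"
        "compact B" "\<And>\<nu>. \<exists>w\<in>B. eps_opt \<nu> 0 w" by blast
      show "(\<forall>lstar l. penalty_threshold nrm (value_fun Y D g H) xstar lstar \<and> lstar \<le> l \<longrightarrow>
          (\<exists>\<epsilon> w. (\<forall>\<nu>. 0 \<le> \<epsilon> \<nu>) \<and> \<epsilon> \<longlonglongrightarrow> 0 \<and> (\<forall>\<nu>. eps_opt \<nu> (\<epsilon> \<nu>) (w \<nu>)) \<and>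
            w \<longlonglongrightarrow> (xstar, ystar, 0, 0, l))) \<and> mn \<longlonglongrightarrow> m \<and> \<bar>m\<bar> \<noteq> \<infinity>"
        using mn_tendsto[OF B] star(5) by (intro conjI allI impI eps_optimal_recovery[OF B]) auto
    qed
    show ?c
    proof (intro allI impI, elim conjE)
      fix \<epsilon> x y u \<alpha> l N xhat yhat uhat \<alpha>hat lhat
      assume "filterlim \<sigma> at_top sequentially" "filterlim \<theta> at_top sequentially" "\<epsilon> \<longlonglongrightarrow> 0"
        "\<forall>\<nu>. eps_opt \<nu> (\<epsilon> \<nu>) (x \<nu>, y \<nu>, u \<nu>, \<alpha> \<nu>, l \<nu>)" "infinite N"
        "((\<lambda>\<nu>. (x \<nu>, y \<nu>, u \<nu>, \<alpha> \<nu>, l \<nu>)) \<longlongrightarrow> (xhat, yhat, uhat, \<alpha>hat, lhat)) (along N)"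
      note cluster = cluster_point_optimal[OF this(1,2,3) spec[OF this(4)] this(5,6)]
      show "P_optimal X Y D f g H \<tau> xhat yhat \<and> (mn \<longlongrightarrow> m) (along N) \<and> \<bar>m\<bar> \<noteq> \<infinity>"
        using cluster star(5) by simp
    qed
  qed
qed

end
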